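(* Every open, bounded, simply connected polygonal region $\Omega\subseteq\mathbb{R}^2$ has a bipartite triangulation.
   Context: A triangulation $\mathcal{T}$ of a bounded open polygonal domain $\mathcal{O}\subseteq\mathbb{R}^2$ (as usual, a domain equal to the interior of its closure, so no slits) is a finite conforming family of closed non-degenerate triangles: their union is the closure of $\mathcal{O}$, and any two distinct triangles meet in the empty set, a common vertex, or a common side. The associated graph $\mathcal{G}_{\mathcal{T}}$ has the triangles of $\mathcal{T}$ as vertices, with an arc between distinct $K,L\in\mathcal{T}$ if $|\partial K\cap\partial L|>0$ (length), i.e. if they share a common side. The triangulation is called bipartite if $\mathcal{G}_{\mathcal{T}}$ is a bipartite graph. Polygonal domains admit triangulations. *)

theory Defs
  imports "HOL-Analysis.Analysis" "Graph_Theory.Pair_Digraph"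
begin

text \<open>The first conjunct excludes slits and punctures, and makes \<open>\<Omega>\<close> open. The boundary is not
  required to be a simple closed curve: it may have several components or touch itself at vertices.\<close>

definition polygonal_region :: "(real ^ 2) set \<Rightarrow> bool" where
  "polygonal_region \<Omega> \<longleftrightarrow>
     interior (closure \<Omega>) = \<Omega> \<and>
     (\<exists>S. finite S \<and> frontier \<Omega> = (\<Union>(a, b)\<in>S. closed_segment a b))"

text \<open>Conformity is contained in the library's \<^const>\<open>triangulation\<close>, which requires the
  intersection of any two members to be a face of each of them. For two distinct triangles such a
  face is empty, a vertex or a side.\<close>

definition triangulation_of :: "(real ^ 2) set set \<Rightarrow> (real ^ 2) set \<Rightarrow> bool" where
  "triangulation_of \<T> \<Omega> \<longleftrightarrow>
     triangulation \<T> \<and> (\<forall>K\<in>\<T>. 2 simplex K) \<and> \<Union>\<T> = closure \<Omega>"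

text \<open>Undirected graphs are represented as symmetric digraphs.\<close>

definition associated_graph :: "(real ^ 2) set set \<Rightarrow> (real ^ 2) set pair_pre_digraph" where
  "associated_graph \<T> =
     \<lparr> pverts = \<T>,
       parcs = {(K, L). K \<in> \<T> \<and> L \<in> \<T> \<and> K \<noteq> L \<and> (\<exists>s. s edge_of K \<and> s edge_of L)} \<rparr>"

definition bipartite :: "'a pair_pre_digraph \<Rightarrow> bool" where
  "bipartite G \<longleftrightarrow>
     (\<exists>U V. pverts G = U \<union> V \<and> U \<inter> V = {} \<and>
        (\<forall>(x, y)\<in>parcs G. x \<in> U \<and> y \<in> V \<or> x \<in> V \<and> y \<in> U))"

end

theory Submission
  imports Defs
begin

text \<open>Cutting a square around \<open>\<Omega>\<close> along all lines through the boundary segments and triangulating the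
  resulting cells gives a triangulation of \<open>closure \<Omega>\<close>. Its barycentric subdivision has one triangle
  for every flag \<open>({a}, {a, b}, {a, b, c})\<close>, that is for every ordering \<open>(a, b, c)\<close> of the vertices of
  an old triangle. Two adjacent small triangles differ in exactly one member of the flag, and such a
  change reverses the orientation of \<open>(a, b, c)\<close>, so the orientation is a proper 2-colouring.\<close>

section \<open>Triangulating the closure of a polygonal region\<close>

lemma closed_segment_subset_line:
  fixes a b :: "real^2"
  obtains n d where "n \<noteq> 0" "\<And>x. x \<in> closed_segment a b \<Longrightarrow> n \<bullet> x = d"
proof -
  \<comment> \<open>A quarter turn of \<open>b - a\<close>; for a degenerate segment any line
    through the point serves.\<close>
  define n :: "real^2" where "n = (if a = b then axis 1 1 else vector [a$2 - b$2, b$1 - a$1])"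
  have "n \<noteq> 0"
    by (auto simp: n_def vec_eq_iff forall_2)
  moreover have "n \<bullet> x = n \<bullet> a" if x: "x \<in> closed_segment a b" for x
  proof (cases "a = b")
    case False
    obtain u where u: "x = (1 - u) *\<^sub>R a + u *\<^sub>R b"
      using x unfolding closed_segment_def by blast
    show ?thesis
      unfolding u using False by (simp add: n_def inner_vec_def sum_2 algebra_simps)
  qed (use x in auto)
  ultimately show ?thesis
    using that by blast
qed

text \<open>A cell on one closed side of every given hyperplane has its interior strictly on that
  side, and subdividing the cells into simplices preserves this.\<close>

lemma cbox_triangulation_avoiding_hyperplanes:
  fixes p q :: "'a::euclidean_space"
  assumes "box p q \<noteq> {}" and "finite I" and nz: "\<And>n d. (n, d) \<in> I \<Longrightarrow> n \<noteq> 0"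
  obtains \<T> where "triangulation \<T>" "\<And>K. K \<in> \<T> \<Longrightarrow> aff_dim K = DIM('a)"
    "\<Union>\<T> = cbox p q" "\<And>K n d x. \<lbrakk>K \<in> \<T>; (n, d) \<in> I; x \<in> interior K\<rbrakk> \<Longrightarrow> n \<bullet> x \<noteq> d"
proof -
  let ?D = "int DIM('a)"
  have "\<exists>\<G>. \<Union>\<G> = \<Union>{cbox p q} \<and> finite \<G> \<and> (\<forall>C \<in> \<G>. \<exists>D. D \<in> {cbox p q} \<and> C \<subseteq> D) \<and>
      (\<forall>C \<in> {cbox p q}. \<forall>x \<in> C. \<exists>D. D \<in> \<G> \<and> x \<in> D \<and> D \<subseteq> C) \<and>
      (\<forall>X \<in> \<G>. polytope X) \<and> (\<forall>X \<in> \<G>. aff_dim X \<le> ?D) \<and>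
      (\<forall>X \<in> \<G>. \<forall>Y \<in> \<G>. X \<inter> Y face_of X) \<and>
      (\<forall>X \<in> \<G>. \<forall>x \<in> X. \<forall>y \<in> X. \<forall>a b. (a,b) \<in> I \<longrightarrow>
          a \<bullet> x \<le> b \<and> a \<bullet> y \<le> b \<or> a \<bullet> x \<ge> b \<and> a \<bullet> y \<ge> b)"
    by (rule cell_subdivision_lemma)
      (use \<open>finite I\<close> in \<open>auto simp: polytope_interval aff_dim_le_DIM intro: face_of_refl\<close>)
  then obtain \<G> where G: "\<Union>\<G> = cbox p q" "finite \<G>" and poly: "\<forall>X\<in>\<G>. polytope X"
    and face: "\<forall>X\<in>\<G>. \<forall>Y\<in>\<G>. X \<inter> Y face_of X"
    and side: "\<forall>X\<in>\<G>. \<forall>x\<in>X. \<forall>y\<in>X. \<forall>a b. (a, b) \<in> I \<longrightarrow>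
          a \<bullet> x \<le> b \<and> a \<bullet> y \<le> b \<or> a \<bullet> x \<ge> b \<and> a \<bullet> y \<ge> b"
    by (elim exE conjE) (simp only: Union_insert Union_empty Un_empty_right)
  have dim: "aff_dim (cbox p q) = ?D"
    using assms(1) by (intro aff_dim_nonempty_interior) auto
  have "\<Union>{C \<in> \<G>. aff_dim C = aff_dim (cbox p q)} = cbox p q"
    using G poly
    by (intro convex_Union_fulldim_cells) (auto intro: polytope_imp_closed polytope_imp_convex)
  \<comment> \<open>The mesh bound \<open>1\<close> is arbitrary; what matters is that every simplex
    lies in a cell.\<close>
  moreover obtain \<T> where \<T>: "triangulation \<T>" "\<And>K. K \<in> \<T> \<Longrightarrow> aff_dim K = ?D"
      "\<Union>\<T> = \<Union>{C \<in> \<G>. aff_dim C = ?D}"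
    and sub: "\<And>K. K \<in> \<T> \<Longrightarrow> \<exists>C. C \<in> {C \<in> \<G>. aff_dim C = ?D} \<and> K \<subseteq> C"
    by (rule fine_triangular_subdivision_of_cell_complex
          [of 1 "{C \<in> \<G>. aff_dim C = ?D}" ?D])
      (use G(2) poly face in auto)
  moreover have "n \<bullet> x \<noteq> d" if K: "K \<in> \<T>" "(n, d) \<in> I" "x \<in> interior K" for K n d x
  proof -
    obtain C where C: "C \<in> \<G>" "K \<subseteq> C"
      using sub K(1) by blast
    have "C \<subseteq> {y. n \<bullet> y \<le> d} \<or> C \<subseteq> {y. n \<bullet> y \<ge> d}"
    proof (rule ccontr)
      assume "\<not> ?thesis"
      then obtain y z where "y \<in> C" "z \<in> C" "n \<bullet> y > d" "n \<bullet> z < d"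
        by (force simp: not_le)
      with side C(1) K(2) show False
        by (meson leD)
    qed
    then have "x \<in> interior {y. n \<bullet> y \<le> d} \<or> x \<in> interior {y. n \<bullet> y \<ge> d}"
      using that(3) C(2) interior_mono by blast
    then show ?thesis
      using nz[OF that(2)] by (auto simp: interior_halfspace_le interior_halfspace_ge)
  qed
  ultimately show ?thesis
    using that dim by metis
qed

text \<open>The interiors of the triangles of a surrounding box avoid every line that carries a
  boundary segment. Such an interior is connected and misses the frontier, so it lies inside
  \<Omega> or outside it; the triangles contained in the closure of \<Omega> are kept.\<close>

lemma polygonal_triangulation_exists:
  fixes \<Omega> :: "(real^2) set"
  assumes "open \<Omega>" "bounded \<Omega>"
    and fin: "finite S" and fr: "frontier \<Omega> \<subseteq> (\<Union>(a, b)\<in>S. closed_segment a b)"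
  obtains \<T> where "triangulation_of \<T> \<Omega>"
proof -
  have "\<exists>n d. n \<noteq> 0 \<and> (\<forall>x \<in> closed_segment (fst s) (snd s). n \<bullet> x = d)" for s :: "(real^2) \<times> (real^2)"
    using closed_segment_subset_line[of "fst s" "snd s"] by metis
  then obtain n d where n: "\<And>s. n s \<noteq> (0::real^2)"
    and d: "\<And>s x. x \<in> closed_segment (fst s) (snd s) \<Longrightarrow> n s \<bullet> x = d s"
    by metis
  obtain p where p: "closure \<Omega> \<subseteq> box (-p) p"
    using bounded_subset_box_symmetric[of "closure \<Omega>"] assms(2) by auto
  then have sub: "closure \<Omega> \<subseteq> cbox (-p) p"
    using box_subset_cbox by blast
  show thesis
  proof (cases "\<Omega> = {}")
    case True
    then show ?thesis
      using that[of "{}"] by (auto simp: triangulation_of_def triangulation_def)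
  next
    case False
    then have "box (-p) p \<noteq> {}"
      using p closure_subset by blast
    then obtain \<T> where \<T>: "triangulation \<T>" and dim: "\<And>K. K \<in> \<T> \<Longrightarrow> aff_dim K = int DIM(real^2)"
      and Un: "\<Union>\<T> = cbox (-p) p"
      and avoid: "\<And>K n' d' x. \<lbrakk>K \<in> \<T>; (n', d') \<in> (\<lambda>s. (n s, d s)) ` S; x \<in> interior K\<rbrakk> \<Longrightarrow> n' \<bullet> x \<noteq> d'"
      by (rule cbox_triangulation_avoiding_hyperplanes[of "-p" p "(\<lambda>s. (n s, d s)) ` S"])
        (use n fin in auto)
    have fin\<T>: "finite \<T>" and simp\<T>: "\<And>K. K \<in> \<T> \<Longrightarrow> \<exists>n. n simplex K"
      using \<T> by (auto simp: triangulation_def)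
    have simplex2: "2 simplex K" if "K \<in> \<T>" for K
      using simp\<T>[OF that] dim[OF that] aff_dim_simplex by fastforce
    have cl: "closed K" if "K \<in> \<T>" for K
      using closed_simplex simplex2 that by blast
    have clint: "closure (interior K) = K" if "K \<in> \<T>" for K
    proof -
      have "convex K" "affine hull K = UNIV"
        using convex_simplex simplex2 that dim[OF that] aff_dim_eq_full by blast+
      then show ?thesis
        by (metis that cl closure_closed convex_closure_rel_interior rel_interior_interior)
    qed
    have inside: "interior K \<subseteq> \<Omega>" if "K \<in> \<T>" "interior K \<inter> \<Omega> \<noteq> {}" for K
    proof -
      have "convex K"
        using convex_simplex simplex2 that by blast
      then have "connected (interior K)"
        by (simp add: convex_connected)
      moreover have "x \<notin> frontier \<Omega>" if x: "x \<in> interior K" for x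
      proof
        assume "x \<in> frontier \<Omega>"
        then obtain s where s: "s \<in> S" "x \<in> closed_segment (fst s) (snd s)"
          using fr by force
        then have "(n s, d s) \<in> (\<lambda>s. (n s, d s)) ` S"
          by blast
        then show False
          using avoid[OF \<open>K \<in> \<T>\<close> _ x] d[OF s(2)] by blast
      qed
      ultimately show ?thesis
        using connected_Int_frontier that(2) by blast
    qed
    define \<T>' where "\<T>' = {K \<in> \<T>. K \<subseteq> closure \<Omega>}"
    have clU: "closed (\<Union>\<T>')"
      using fin\<T> cl by (auto simp: \<T>'_def)
    \<comment> \<open>An uncovered point would have the open neighbourhood
      \<open>\<Omega> - \<Union>\<T>'\<close>. A triangle containing the point is the closure of its
      interior, so that interior meets \<Omega> and the triangle was kept after all.\<close>
    have "\<Omega> \<subseteq> \<Union>\<T>'"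
    proof (rule ccontr)
      assume "\<not> ?thesis"
      then obtain x where x: "x \<in> \<Omega> - \<Union>\<T>'"
        by blast
      then obtain K where K: "K \<in> \<T>" "x \<in> K"
        using Un sub closure_subset by blast
      have opn: "open (\<Omega> - \<Union>\<T>')"
        using clU assms(1) by blast
      then have "interior K \<inter> (\<Omega> - \<Union>\<T>') \<noteq> {}"
        using open_Int_closure_eq_empty[OF opn, of "interior K"] clint[OF K(1)] K(2) x by auto
      then have "interior K \<subseteq> \<Omega>"
        using inside K(1) by blast
      then have "K \<subseteq> closure \<Omega>"
        using closure_mono[of "interior K" \<Omega>] clint[OF K(1)] by simp
      then show False
        using K x by (auto simp: \<T>'_def)
    qed
    then have "\<Union>\<T>' = closure \<Omega>"
      using closure_minimal[OF _ clU] by (auto simp: \<T>'_def)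
    moreover have "triangulation \<T>'"
      using \<T> by (auto simp: \<T>'_def triangulation_def)
    ultimately show ?thesis
      using that[of \<T>'] simplex2 by (auto simp: triangulation_of_def \<T>'_def)
  qed
qed

section \<open>Flag triangles inside one triangle\<close>

lemma convex_hull_3I:
  "\<lbrakk>0 \<le> u; 0 \<le> v; 0 \<le> w; u + v + w = 1\<rbrakk> \<Longrightarrow> u *\<^sub>R a + v *\<^sub>R b + w *\<^sub>R c \<in> convex hull {a, b, c}"
  unfolding convex_hull_3 by blast

text \<open>The vertices are the barycentres of the members of the flag \<open>{a}\<close>,
  \<open>{a, b}\<close>, \<open>{a, b, c}\<close>.\<close>

definition flag_triangle :: "'a \<Rightarrow> 'a \<Rightarrow> 'a \<Rightarrow> 'a::real_vector set" where
  "flag_triangle a b c = convex hull {a, (1/2) *\<^sub>R (a + b), (1/3) *\<^sub>R (a + b + c)}"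

text \<open>Weights \<open>r\<close>, \<open>s\<close>, \<open>t\<close> on the three barycentres
  amount to the coordinates \<open>u = r + s/2 + t/3\<close>, \<open>v = s/2 + t/3\<close>,
  \<open>w = t/3\<close>, with inverse \<open>r = u - v\<close>, \<open>s = 2 * (v - w)\<close>,
  \<open>t = 3 * w\<close>. Nonnegativity of the weights is the ordering of the coordinates.\<close>

lemma flag_triangle_iff:
  "x \<in> flag_triangle a b c \<longleftrightarrow>
     (\<exists>u v w. 0 \<le> w \<and> w \<le> v \<and> v \<le> u \<and> u + v + w = 1 \<and> x = u *\<^sub>R a + v *\<^sub>R b + w *\<^sub>R c)"
proof
  assume "x \<in> flag_triangle a b c"
  then obtain r s t where "0 \<le> r" "0 \<le> s" "0 \<le> t" "r + s + t = 1"
    "x = r *\<^sub>R a + s *\<^sub>R (1/2) *\<^sub>R (a + b) + t *\<^sub>R (1/3) *\<^sub>R (a + b + c)"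
    unfolding flag_triangle_def convex_hull_3 by blast
  moreover from this(5) have "x = (r + s/2 + t/3) *\<^sub>R a + (s/2 + t/3) *\<^sub>R b + (t/3) *\<^sub>R c"
    by (simp add: algebra_simps)
  moreover have "0 \<le> t/3" "t/3 \<le> s/2 + t/3" "s/2 + t/3 \<le> r + s/2 + t/3"
    "(r + s/2 + t/3) + (s/2 + t/3) + t/3 = 1"
    using calculation(1-4) by auto
  ultimately show "\<exists>u v w. 0 \<le> w \<and> w \<le> v \<and> v \<le> u \<and> u + v + w = 1 \<and> x = u *\<^sub>R a + v *\<^sub>R b + w *\<^sub>R c"
    by blast
next
  assume "\<exists>u v w. 0 \<le> w \<and> w \<le> v \<and> v \<le> u \<and> u + v + w = 1 \<and> x = u *\<^sub>R a + v *\<^sub>R b + w *\<^sub>R c"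
  then obtain u v w where w: "0 \<le> w" "w \<le> v" "v \<le> u" "u + v + w = 1"
    and x: "x = u *\<^sub>R a + v *\<^sub>R b + w *\<^sub>R c"
    by blast
  from w have "0 \<le> u - v" "0 \<le> 2 * (v - w)" "0 \<le> 3 * w" "(u - v) + 2 * (v - w) + 3 * w = 1"
    by simp_all
  note convex_hull_3I[OF this, of a "(1/2) *\<^sub>R (a + b)" "(1/3) *\<^sub>R (a + b + c)"]
  also have "(u - v) *\<^sub>R a + (2 * (v - w)) *\<^sub>R (1/2) *\<^sub>R (a + b) + (3 * w) *\<^sub>R (1/3) *\<^sub>R (a + b + c) = x"
    unfolding x by (simp add: algebra_simps)
  finally show "x \<in> flag_triangle a b c"
    unfolding flag_triangle_def .
qed

lemma flag_triangleI:
  "\<lbrakk>0 \<le> w; w \<le> v; v \<le> u; u + v + w = 1\<rbrakk> \<Longrightarrow> u *\<^sub>R a + v *\<^sub>R b + w *\<^sub>R c \<in> flag_triangle a b c"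
  using flag_triangle_iff by blast

lemma flag_triangle_subset: "flag_triangle a b c \<subseteq> convex hull {a, b, c}"
proof
  fix x assume "x \<in> flag_triangle a b c"
  then obtain u v w where "0 \<le> w" "w \<le> v" "v \<le> u" "u + v + w = 1" "x = u *\<^sub>R a + v *\<^sub>R b + w *\<^sub>R c"
    unfolding flag_triangle_iff by blast
  moreover from this have "0 \<le> v" "0 \<le> u"
    by linarith+
  ultimately show "x \<in> convex hull {a, b, c}"
    using convex_hull_3I by blast
qed

text \<open>Sorting the barycentric coordinates of \<open>x\<close> in decreasing order picks a
  piece that contains it; the cases are the six orders.\<close>

lemma convex_hull_3_in_flag_triangle:
  assumes "x \<in> convex hull {a, b, c}"
  obtains a' b' c' where "{a', b', c'} = {a, b, c}" "x \<in> flag_triangle a' b' c'"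
proof -
  obtain u v w where *: "0 \<le> u" "0 \<le> v" "0 \<le> w" "u + v + w = 1" "x = u *\<^sub>R a + v *\<^sub>R b + w *\<^sub>R c"
    using assms unfolding convex_hull_3 by blast
  consider "w \<le> v" "v \<le> u" | "v \<le> w" "w \<le> u" | "w \<le> u" "u \<le> v" | "u \<le> w" "w \<le> v"
    | "v \<le> u" "u \<le> w" | "u \<le> v" "v \<le> w"
    by linarith
  then show thesis
  proof cases
    case 1
    then have "x \<in> flag_triangle a b c"
      using * flag_triangleI[of w v u a b c] by (simp add: ac_simps)
    then show thesis by (intro that) auto
  next
    case 2
    then have "x \<in> flag_triangle a c b"
      using * flag_triangleI[of v w u a c b] by (simp add: ac_simps)
    then show thesis by (intro that) auto
  next
    case 3
    then have "x \<in> flag_triangle b a c"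
      using * flag_triangleI[of w u v b a c] by (simp add: ac_simps)
    then show thesis by (intro that) auto
  next
    case 4
    then have "x \<in> flag_triangle b c a"
      using * flag_triangleI[of u w v b c a] by (simp add: ac_simps)
    then show thesis by (intro that) auto
  next
    case 5
    then have "x \<in> flag_triangle c a b"
      using * flag_triangleI[of v u w c a b] by (simp add: ac_simps)
    then show thesis by (intro that) auto
  next
    case 6
    then have "x \<in> flag_triangle c b a"
      using * flag_triangleI[of u v w c b a] by (simp add: ac_simps)
    then show thesis by (intro that) auto
  qed
qed

section \<open>Intersections of flag triangles\<close>

text \<open>A face of a simplex is spanned by some of its vertices, and these are the extreme points
  of the face. So one and the same vertex set, contained in \<open>V\<close> and in
  \<open>W\<close>, spans the intersection.\<close>

lemma convex_hull_Int_of_face: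
  fixes V W :: "'a::euclidean_space set"
  assumes V: "\<not> affine_dependent V" and W: "\<not> affine_dependent W"
    and "convex hull V \<inter> convex hull W face_of convex hull V"
    and "convex hull V \<inter> convex hull W face_of convex hull W"
  shows "convex hull V \<inter> convex hull W = convex hull (V \<inter> W)"
proof -
  obtain C D where "C \<subseteq> V" "D \<subseteq> W" and CD: "convex hull V \<inter> convex hull W = convex hull C" "convex hull V \<inter> convex hull W = convex hull D"
    using assms face_of_convex_hull_affine_independent by metis
  have "\<not> affine_dependent C" "\<not> affine_dependent D"
    using V W \<open>C \<subseteq> V\<close> \<open>D \<subseteq> W\<close> affine_independent_subset by blast+
  then have "C = D"
    using CD extreme_point_of_convex_hull_affine_independent[of C]
      extreme_point_of_convex_hull_affine_independent[of D] by auto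
  then have "convex hull V \<inter> convex hull W \<subseteq> convex hull (V \<inter> W)"
    using CD \<open>C \<subseteq> V\<close> \<open>D \<subseteq> W\<close> by (simp add: hull_mono)
  then show ?thesis
    by (simp add: hull_mono subset_antisym)
qed

lemma affine_independent_coeffs_unique:
  fixes V :: "'a::euclidean_space set"
  assumes "\<not> affine_dependent V" "sum f V = sum g V" "(\<Sum>v\<in>V. f v *\<^sub>R v) = (\<Sum>v\<in>V. g v *\<^sub>R v)" "v \<in> V"
  shows "f v = g v"
proof (rule ccontr)
  assume "f v \<noteq> g v"
  have "finite V"
    using assms(1) aff_independent_finite by blast
  then have "affine_dependent V"
    unfolding affine_dependent_explicit_finite[OF \<open>finite V\<close>]
    by (intro exI[of _ "\<lambda>v. f v - g v"])
      (use assms \<open>f v \<noteq> g v\<close> in \<open>auto simp: sum_subtractf algebra_simps\<close>)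
  then show False using assms(1) by blast
qed

text \<open>Lets barycentric coordinates be compared across two simplices: the point lies in the
  hull of the common vertices, and its coordinates there, extended by zero, are its coordinates in
  both.\<close>

lemma convex_coeffs_eq:
  fixes V W :: "'a::euclidean_space set"
  assumes V: "\<not> affine_dependent V" and W: "\<not> affine_dependent W"
    and Int: "convex hull V \<inter> convex hull W \<subseteq> convex hull (V \<inter> W)"
    and f: "\<And>v. f v \<ge> 0" "sum f V = 1" "\<And>v. v \<notin> V \<Longrightarrow> f v = 0"
    and g: "\<And>v. g v \<ge> 0" "sum g W = 1" "\<And>v. v \<notin> W \<Longrightarrow> g v = 0"
    and eq: "(\<Sum>v\<in>V. f v *\<^sub>R v) = (\<Sum>v\<in>W. g v *\<^sub>R v)"
  shows "f = g"
proof -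
  have fin: "finite V" "finite W"
    using V W aff_independent_finite by blast+
  then have "(\<Sum>v\<in>V. f v *\<^sub>R v) \<in> convex hull V" "(\<Sum>v\<in>W. g v *\<^sub>R v) \<in> convex hull W"
    using f g by (auto simp: convex_hull_finite)
  then have "(\<Sum>v\<in>V. f v *\<^sub>R v) \<in> convex hull (V \<inter> W)"
    using Int eq by auto
  then obtain h where h: "sum h (V \<inter> W) = 1" "(\<Sum>v\<in>V\<inter>W. h v *\<^sub>R v) = (\<Sum>v\<in>V. f v *\<^sub>R v)"
    using fin by (auto simp: convex_hull_finite)
  define k where "k v = (if v \<in> V \<inter> W then h v else 0)" for v
  have k: "sum k U = 1" "(\<Sum>v\<in>U. k v *\<^sub>R v) = (\<Sum>v\<in>V. f v *\<^sub>R v)" if "V \<inter> W \<subseteq> U" "finite U" for U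
  proof -
    have "sum k U = sum h (V \<inter> W)" 
      using that by (intro sum.mono_neutral_cong_right) (auto simp: k_def)
    then show "sum k U = 1" using h by simp
    have "(\<Sum>v\<in>U. k v *\<^sub>R v) = (\<Sum>v\<in>V\<inter>W. h v *\<^sub>R v)"
      using that by (intro sum.mono_neutral_cong_right) (auto simp: k_def)
    then show "(\<Sum>v\<in>U. k v *\<^sub>R v) = (\<Sum>v\<in>V. f v *\<^sub>R v)" using h by simp
  qed
  have "f v = k v" for v
    using affine_independent_coeffs_unique[OF V, of f k v] k[of V] f fin
    by (cases "v \<in> V") (auto simp: k_def)
  moreover have "g v = k v" for v
    using affine_independent_coeffs_unique[OF W, of g k v] k[of W] g eq fin
    by (cases "v \<in> W") (auto simp: k_def)
  ultimately show ?thesis by auto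
qed

text \<open>The coordinates become a total function, zero off the vertices, so that those of
  different flags can be compared as functions. The last equation gives the weights on the three
  barycentres.\<close>

lemma flag_triangle_coeffs:
  assumes "x \<in> flag_triangle a b c" "a \<noteq> b" "b \<noteq> c" "a \<noteq> c"
  obtains f where "0 \<le> f c" "f c \<le> f b" "f b \<le> f a" "sum f {a, b, c} = 1"
    "\<And>v. v \<notin> {a, b, c} \<Longrightarrow> f v = 0" "\<And>v. f v \<ge> 0"
    "x = (\<Sum>v\<in>{a, b, c}. f v *\<^sub>R v)"
    "x = (f a - f b) *\<^sub>R a + (2 * (f b - f c)) *\<^sub>R (1/2) *\<^sub>R (a + b) + (3 * f c) *\<^sub>R (1/3) *\<^sub>R (a + b + c)"
proof -
  obtain u v w where *: "0 \<le> w" "w \<le> v" "v \<le> u" "u + v + w = 1" "x = u *\<^sub>R a + v *\<^sub>R b + w *\<^sub>R c"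
    using assms(1) unfolding flag_triangle_iff by blast
  define f where "f = (\<lambda>_. 0 :: real)(a := u, b := v, c := w)"
  have f [simp]: "f a = u" "f b = v" "f c = w" "\<And>v. v \<notin> {a, b, c} \<Longrightarrow> f v = 0"
    using assms by (auto simp: f_def)
  have "f v \<ge> 0" for v
    using * by (auto simp: f_def)
  moreover have "x = (f a - f b) *\<^sub>R a + (2 * (f b - f c)) *\<^sub>R (1/2) *\<^sub>R (a + b) + (3 * f c) *\<^sub>R (1/3) *\<^sub>R (a + b + c)"
    by (simp add: *(5) algebra_simps flip: scaleR_add_left)
  moreover have "sum f {a, b, c} = 1" "x = (\<Sum>v\<in>{a, b, c}. f v *\<^sub>R v)"
    using *(4,5) assms(2-) by (simp_all add: add.assoc)
  ultimately show thesis
    using *(1-3) by (intro that[of f]) (simp_all only: f(1-3), simp add: f_def)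
qed

text \<open>For distinct vertices, flag members at different levels have different sizes, so two
  flags are compared level by level.\<close>

definition common_barycentres :: "'a \<Rightarrow> 'a \<Rightarrow> 'a \<Rightarrow> 'a \<Rightarrow> 'a \<Rightarrow> 'a \<Rightarrow> 'a::real_vector set" where
  "common_barycentres a b c a' b' c' =
     (if a = a' then {a} else {}) \<union>
     (if {a, b} = {a', b'} then {(1/2) *\<^sub>R (a + b)} else {}) \<union>
     (if {a, b, c} = {a', b', c'} then {(1/3) *\<^sub>R (a + b + c)} else {})"

lemma flag_triangle_Int:
  fixes a b c a' b' c' :: "'a::euclidean_space"
  assumes indep: "\<not> affine_dependent {a, b, c}" "\<not> affine_dependent {a', b', c'}"
    and dist: "a \<noteq> b" "b \<noteq> c" "a \<noteq> c" "a' \<noteq> b'" "b' \<noteq> c'" "a' \<noteq> c'"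
    and Int: "convex hull {a, b, c} \<inter> convex hull {a', b', c'} \<subseteq> convex hull ({a, b, c} \<inter> {a', b', c'})"
  shows "flag_triangle a b c \<inter> flag_triangle a' b' c' \<subseteq>
     convex hull (common_barycentres a b c a' b' c')"
proof
  fix x assume "x \<in> flag_triangle a b c \<inter> flag_triangle a' b' c'"
  then have x: "x \<in> flag_triangle a b c" "x \<in> flag_triangle a' b' c'"
    by auto
  obtain f where f: "0 \<le> f c" "f c \<le> f b" "f b \<le> f a" "sum f {a, b, c} = 1"
    "\<And>v. v \<notin> {a, b, c} \<Longrightarrow> f v = 0" "\<And>v. f v \<ge> 0"
    "x = (\<Sum>v\<in>{a, b, c}. f v *\<^sub>R v)"
    "x = (f a - f b) *\<^sub>R a + (2 * (f b - f c)) *\<^sub>R (1/2) *\<^sub>R (a + b) + (3 * f c) *\<^sub>R (1/3) *\<^sub>R (a + b + c)"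
    by (rule flag_triangle_coeffs[OF x(1) dist(1-3)]) blast
  obtain g where g: "0 \<le> g c'" "g c' \<le> g b'" "g b' \<le> g a'" "sum g {a', b', c'} = 1"
    "\<And>v. v \<notin> {a', b', c'} \<Longrightarrow> g v = 0" "\<And>v. g v \<ge> 0"
    "x = (\<Sum>v\<in>{a', b', c'}. g v *\<^sub>R v)"
    by (rule flag_triangle_coeffs[OF x(2) dist(4-6)]) blast
  have "f = g"
    using convex_coeffs_eq[OF indep Int f(6,4,5) g(6,4,5)] f(7) g(7) by metis
  note g = g[folded this]
  \<comment> \<open>A member of the flag has positive weight in \<open>x\<close> only if it is a superlevel set of the barycentric
    coordinates \<open>f\<close> of \<open>x\<close>, and \<open>f\<close> is the same for both flags.\<close>
  have fmax: "f v \<le> f a" "v \<noteq> a \<Longrightarrow> f v \<le> f b" "v \<noteq> a \<Longrightarrow> v \<noteq> b \<Longrightarrow> f v \<le> f c" for v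
    using f(1-3) f(5)[of v] by (cases "v \<in> {a, b, c}"; force)+
  have gmax: "f v \<le> f a'" "v \<noteq> a' \<Longrightarrow> f v \<le> f b'" for v
    using g(1-3) g(5)[of v] by (cases "v \<in> {a', b', c'}"; force)+
  have A: "a = a'" if "f a - f b \<noteq> 0"
    using that f(3) fmax(2)[of a'] gmax(1)[of a] by fastforce
  have B: "{a, b} = {a', b'}" if "2 * (f b - f c) \<noteq> 0"
  proof -
    have less: "f c < f b"
      using that f(2) by simp
    have "a' \<in> {a, b}"
      using less fmax(3)[of a'] gmax(1)[of b] by fastforce
    \<comment> \<open>Otherwise \<open>a\<close> and \<open>b\<close> would both have larger values
      than \<open>b'\<close>, but only \<open>a'\<close> can.\<close>
    moreover have "b' \<in> {a, b}"
    proof (rule ccontr)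
      assume "b' \<notin> {a, b}"
      then have "f b' < f b" "f b' < f a"
        using less fmax(3)[of b'] f(3) by auto
      then have "a = a'" "b = a'"
        using gmax(2)[of a] gmax(2)[of b] by linarith+
      then show False
        using dist(1) by simp
    qed
    ultimately show ?thesis
      using dist(1,4) by blast
  qed
  \<comment> \<open>If \<open>f c\<close> is positive then so are all three coordinates, so the
    support of \<open>f\<close> is \<open>{a, b, c}\<close> and lies in
    \<open>{a', b', c'}\<close>.\<close>
  have C: "{a, b, c} = {a', b', c'}" if "3 * f c \<noteq> 0"
  proof (rule card_subset_eq)
    have "f c > 0" "f b > 0" "f a > 0"
      using that f(1-3) by auto
    then show "{a, b, c} \<subseteq> {a', b', c'}"
      using g(5) by (metis empty_subsetI insert_subset less_irrefl)
  qed (use dist in auto)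
  \<comment> \<open>Only points of non-zero weight have to lie in \<open>S\<close>; the others are
    replaced by an arbitrary member \<open>y\<close>.\<close>
  have conv: "r *\<^sub>R p + s *\<^sub>R q + t *\<^sub>R z \<in> convex hull S"
    if "0 \<le> r" "0 \<le> s" "0 \<le> t" "r + s + t = 1" "r \<noteq> 0 \<Longrightarrow> p \<in> S" "s \<noteq> 0 \<Longrightarrow> q \<in> S" "t \<noteq> 0 \<Longrightarrow> z \<in> S"
    for r s t and p q z :: 'a and S
  proof -
    have "r \<noteq> 0 \<or> s \<noteq> 0 \<or> t \<noteq> 0"
      using that(4) by auto
    then have "\<exists>y. y \<in> S"
      using that(5-7) by blast
    then obtain y where "y \<in> S" ..
    have "r *\<^sub>R p + s *\<^sub>R q + t *\<^sub>R z = r *\<^sub>R (if r = 0 then y else p) + s *\<^sub>R (if s = 0 then y else q) + t *\<^sub>R (if t = 0 then y else z)"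
      by auto
    also have "\<dots> \<in> convex hull {if r = 0 then y else p, if s = 0 then y else q, if t = 0 then y else z}"
      using that(1-4) by (rule convex_hull_3I)
    also have "\<dots> \<subseteq> convex hull S"
      using that \<open>y \<in> S\<close> by (intro hull_mono) auto
    finally show ?thesis .
  qed
  have "f a + f b + f c = 1"
    using f(4) dist by auto
  then show "x \<in> convex hull (common_barycentres a b c a' b' c')"
    unfolding f(8) common_barycentres_def using f(1-3) A B C by (intro conv) auto
qed

section \<open>Orientation in the plane\<close>

text \<open>The determinant of \<open>b - a\<close> and \<open>c - a\<close>, that is twice the
  signed area of the triangle; its sign will be the colour.\<close>

definition orient :: "real^2 \<Rightarrow> real^2 \<Rightarrow> real^2 \<Rightarrow> real" where
  "orient a b c = (b - a)$1 * (c - a)$2 - (b - a)$2 * (c - a)$1"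

lemma orient_swap: "orient b a c = - orient a b c" "orient a c b = - orient a b c"
  by (simp_all add: orient_def algebra_simps)

lemma cramer_orient:
  assumes "orient a b c \<noteq> 0"
  shows "x = a + (orient a x c / orient a b c) *\<^sub>R (b - a) + (orient a b x / orient a b c) *\<^sub>R (c - a)"
proof -
  have "orient a b c *\<^sub>R (x - a) = orient a x c *\<^sub>R (b - a) + orient a b x *\<^sub>R (c - a)"
    by (simp add: orient_def vec_eq_iff forall_2 algebra_simps)
  then have "(1 / orient a b c) *\<^sub>R (orient a b c *\<^sub>R (x - a)) =
      (1 / orient a b c) *\<^sub>R (orient a x c *\<^sub>R (b - a) + orient a b x *\<^sub>R (c - a))"
    by simp
  then have "x - a = (orient a x c / orient a b c) *\<^sub>R (b - a) + (orient a b x / orient a b c) *\<^sub>R (c - a)"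
    using assms by (simp add: scaleR_right_distrib)
  then show ?thesis
    by (simp add: algebra_simps)
qed

lemma orient_nonzero:
  assumes "\<not> affine_dependent {a, b, c}" "a \<noteq> b" "b \<noteq> c" "a \<noteq> c"
  shows "orient a b c \<noteq> 0"
proof
  assume "orient a b c = 0"
  then have 0: "(b$1 - a$1) * (c$2 - a$2) = (b$2 - a$2) * (c$1 - a$1)"
    by (simp add: orient_def)
  \<comment> \<open>A coordinate in which \<open>a\<close> and \<open>b\<close> differ. Differences
    along it supply the coefficients of the affine dependence below.\<close>
  define i :: 2 where "i = (if b$1 = a$1 then 2 else 1)"
  have i: "b$i - a$i \<noteq> 0"
    using assms(2) by (auto simp: i_def vec_eq_iff forall_2)
  have "(b$i - a$i) *\<^sub>R (c - a) = (c$i - a$i) *\<^sub>R (b - a)"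
    using 0 by (auto simp: i_def vec_eq_iff forall_2 algebra_simps)
  then have sum: "(c$i - b$i) *\<^sub>R a + (a$i - c$i) *\<^sub>R b + (b$i - a$i) *\<^sub>R c = 0"
    by (simp add: algebra_simps)
  have "affine_dependent {a, b, c}"
    unfolding affine_dependent_explicit_finite[of "{a,b,c}", simplified]
    using i assms(2-) sum
    by (intro exI[of _ "(\<lambda>_. 0)(a := c$i - b$i, b := a$i - c$i, c := b$i - a$i)"])
      (auto simp: algebra_simps)
  with assms(1) show False ..
qed

text \<open>If \<open>c\<close> and \<open>d\<close> lay strictly on the same side of the line
  through \<open>a\<close> and \<open>b\<close>, a point slightly displaced from the midpoint of
  \<open>a\<close> and \<open>b\<close> towards \<open>d\<close> would lie in both triangles but off
  that line.\<close>

lemma orient_opposite: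
  assumes "orient a b c \<noteq> 0"
    and Int: "convex hull {a, b, c} \<inter> convex hull {a, b, d} \<subseteq> convex hull {a, b}"
  shows "orient a b c * orient a b d \<le> 0"
proof (rule ccontr)
  assume "\<not> ?thesis"
  then have pos: "orient a b c * orient a b d > 0"
    by simp
  define s t where "s = orient a d c / orient a b c" and "t = orient a b d / orient a b c"
  have t: "t > 0"
    using pos by (auto simp: t_def zero_less_divide_iff zero_less_mult_iff)
  have d: "d = a + s *\<^sub>R (b - a) + t *\<^sub>R (c - a)"
    unfolding s_def t_def by (rule cramer_orient[OF assms(1)])
  \<comment> \<open>Chosen so that the weights of \<open>x\<close> with respect to \<open>a\<close>,
    \<open>b\<close>, \<open>c\<close> stay nonnegative; the absolute value covers either sign of
    \<open>s\<close>.\<close>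
  define e where "e = 1 / (2 * (1 + \<bar>s\<bar> + t))"
  have e: "0 < e" "e \<le> 1/2" "e * (1 + \<bar>s\<bar> + t) = 1/2"
    using t by (auto simp: e_def divide_simps)
  have "e * \<bar>s\<bar> + e * t + e = 1/2" "0 < e * t"
    using e t by (auto simp: algebra_simps)
  moreover have "\<bar>e * s\<bar> = e * \<bar>s\<bar>"
    using e by (simp add: abs_mult)
  ultimately have es: "\<bar>e * s\<bar> + e * t + e = 1/2" "0 < e * t"
    by auto
  define x where "x = ((1 - e)/2) *\<^sub>R a + ((1 - e)/2) *\<^sub>R b + e *\<^sub>R d"
  have "x \<in> convex hull {a, b, d}"
    unfolding x_def by (rule convex_hull_3I) (use e in auto)
  moreover have "x = ((1 - e)/2 + e * (1 - s - t)) *\<^sub>R a + ((1 - e)/2 + e * s) *\<^sub>R b + (e * t) *\<^sub>R c"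
    unfolding x_def by (subst d) (simp add: algebra_simps)
  moreover have "\<dots> \<in> convex hull {a, b, c}"
  proof -
    \<comment> \<open>With \<open>p\<close> for \<open>e * s\<close> and \<open>q\<close> for
      \<open>e * t\<close> the claim becomes linear apart from the absolute value.\<close>
    have nonneg: "0 \<le> (1 - e)/2 + (e - p - q) \<and> 0 \<le> (1 - e)/2 + p"
      if "\<bar>p\<bar> + q + e = 1/2" "0 < q" "0 < e" for p q e :: real
      using that by (auto simp: field_simps abs_if split: if_splits)
    have expand: "e * (1 - s - t) = e - e * s - e * t"
      by (simp add: algebra_simps)
    show ?thesis
      unfolding expand using nonneg[OF es e(1)] es(2)
      by (intro convex_hull_3I) (simp_all add: field_simps)
  qed
  ultimately have "x \<in> convex hull {a, b}"
    using Int by blast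
  then obtain u v where uv: "u + v = 1" "x = u *\<^sub>R a + v *\<^sub>R b"
    unfolding convex_hull_2 by blast
  have u: "u = 1 - v"
    using uv(1) by simp
  have "orient a b x = 0"
    unfolding uv(2) u by (simp add: orient_def algebra_simps)
  \<comment> \<open>As a function of its last argument \<open>orient a b\<close> is affine and
    vanishes at \<open>a\<close> and \<open>b\<close>, so only the weight of \<open>d\<close>
    counts.\<close>
  moreover have "orient a b x = e * orient a b d"
    by (simp add: x_def orient_def field_simps)
  ultimately show False
    using e pos by auto
qed

text \<open>Eliminating the coefficient of \<open>a\<close> turns an affine dependence into a linear
  relation between \<open>b - a\<close> and \<open>c - a\<close>; Cramer's rule then makes both
  remaining coefficients vanish.\<close>

lemma orient_nonzero_imp_affine_independent:
  assumes "orient a b c \<noteq> 0"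
  shows "\<not> affine_dependent {a, b, c}" "card {a, b, c} = 3"
proof -
  have dist: "a \<noteq> b" "b \<noteq> c" "a \<noteq> c"
    using assms by (auto simp: orient_def)
  then show "card {a, b, c} = 3"
    by simp
  show "\<not> affine_dependent {a, b, c}"
  proof
    assume "affine_dependent {a, b, c}"
    then obtain u where u: "u a + u b + u c = 0" "u a \<noteq> 0 \<or> u b \<noteq> 0 \<or> u c \<noteq> 0"
      "u a *\<^sub>R a + u b *\<^sub>R b + u c *\<^sub>R c = 0"
      using dist by (auto simp: affine_dependent_explicit_finite algebra_simps)
    then have ua: "u a = - u b - u c"
      by simp
    from u(3) have "u b *\<^sub>R (b - a) + u c *\<^sub>R (c - a) = 0"
      unfolding ua by (simp add: algebra_simps)
    then have *: "u b * (b - a)$i + u c * (c - a)$i = 0" for i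
      by (metis vector_add_component vector_scaleR_component zero_index real_scaleR_def)
    have "u b * orient a b c = (u b * (b - a)$1 + u c * (c - a)$1) * (c - a)$2
        - (u b * (b - a)$2 + u c * (c - a)$2) * (c - a)$1"
      unfolding orient_def by algebra
    then have "u b = 0"
      using * assms by simp
    have "u c * orient a b c = (u b * (b - a)$2 + u c * (c - a)$2) * (b - a)$1
        - (u b * (b - a)$1 + u c * (c - a)$1) * (b - a)$2"
      unfolding orient_def by algebra
    then have "u c = 0"
      using * assms by simp
    with \<open>u b = 0\<close> u ua show False
      by simp
  qed
qed

text \<open>The factor is \<open>1/2\<close> times \<open>1/3\<close>: each of the six pieces has a
  sixth of the area. In particular the pieces of a non-degenerate triangle are
  non-degenerate.\<close>

lemma orient_flag_triangle:
  "orient a ((1/2) *\<^sub>R (a + b)) ((1/3) *\<^sub>R (a + b + c)) = orient a b c / 6"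
  by (simp add: orient_def field_simps)

section \<open>Flags and the barycentric subdivision of a plane triangulation\<close>

lemma two_simplex_hull_3:
  assumes "2 simplex (convex hull {a, b, c})"
  shows "\<not> affine_dependent {a, b, c}" "a \<noteq> b" "b \<noteq> c" "a \<noteq> c"
proof -
  have dim: "aff_dim {a, b, c} = 2"
    using assms aff_dim_simplex aff_dim_convex_hull by metis
  moreover have "aff_dim {a, b, c} \<le> int (card {a, b, c}) - 1"
    by (rule aff_dim_le_card) simp
  moreover have "card {a, b, c} \<le> 3"
    by (simp add: card_insert_if)
  ultimately have "card {a, b, c} = 3"
    by linarith
  then show "a \<noteq> b" "b \<noteq> c" "a \<noteq> c"
    by (auto simp: card_insert_if split: if_splits)
  show "\<not> affine_dependent {a, b, c}"
    using dim \<open>card {a, b, c} = 3\<close> by (simp add: affine_independent_iff_card)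
qed

lemma two_simplex_cases:
  assumes "2 simplex K"
  obtains a b c where "K = convex hull {a, b, c}"
proof -
  obtain C where "card C = 3" "K = convex hull C"
    using assms by (auto simp: simplex_def)
  then show thesis
    using that by (auto simp: card_3_iff)
qed

text \<open>An ordering of the vertices encodes a flag: its first one, two and three entries form
  the members. A convex hull does not see the order, so each triangle contributes all six
  orderings.\<close>

definition flags :: "'a::euclidean_space set set \<Rightarrow> ('a \<times> 'a \<times> 'a) set" where
  "flags \<T> = {(a, b, c). convex hull {a, b, c} \<in> \<T>}"

definition barycentric_subdivision :: "'a::euclidean_space set set \<Rightarrow> 'a set set" where
  "barycentric_subdivision \<T> = (\<lambda>(a, b, c). flag_triangle a b c) ` flags \<T>"

text \<open>The entries of a flag are extreme points of a triangle of \<T>, and a simplex has only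
  finitely many of them.\<close>

lemma finite_flags:
  assumes "finite \<T>" "\<And>K. K \<in> \<T> \<Longrightarrow> 2 simplex K"
  shows "finite (flags \<T>)"
proof -
  let ?E = "\<lambda>K. {x. x extreme_point_of K}"
  have "flags \<T> \<subseteq> (\<Union>K\<in>\<T>. ?E K \<times> ?E K \<times> ?E K)"
    using two_simplex_hull_3(1) assms(2)
    by (fastforce simp: flags_def extreme_point_of_convex_hull_affine_independent)
  moreover have "finite (?E K)" if "K \<in> \<T>" for K
    using assms(2)[OF that] finite_polyhedron_extreme_points simplex_imp_polyhedron by blast
  ultimately show ?thesis
    using assms(1) by (auto intro: finite_subset)
qed

locale plane_triangulation =
  fixes \<T> :: "(real^2) set set"
  assumes triangulation: "triangulation \<T>" and simplex2: "\<And>K. K \<in> \<T> \<Longrightarrow> 2 simplex K"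
begin

lemma flag_independent:
  assumes "(a, b, c) \<in> flags \<T>"
  shows "\<not> affine_dependent {a, b, c}" "a \<noteq> b" "b \<noteq> c" "a \<noteq> c" "orient a b c \<noteq> 0"
proof -
  have "2 simplex (convex hull {a, b, c})"
    using assms simplex2 by (auto simp: flags_def)
  note * = two_simplex_hull_3[OF this]
  show "\<not> affine_dependent {a, b, c}" "a \<noteq> b" "b \<noteq> c" "a \<noteq> c" "orient a b c \<noteq> 0"
    using * orient_nonzero[OF *] by auto
qed

lemma orient_barycentres_nonzero:
  assumes "(a, b, c) \<in> flags \<T>"
  shows "orient a ((1/2) *\<^sub>R (a + b)) ((1/3) *\<^sub>R (a + b + c)) \<noteq> 0"
  using flag_independent(5)[OF assms] by (simp add: orient_flag_triangle)

text \<open>Conformity in terms of vertices: the intersection is a face of both triangles, hence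
  spanned by common vertices.\<close>

lemma hull_Int:
  assumes "(a, b, c) \<in> flags \<T>" "(a', b', c') \<in> flags \<T>"
  shows "convex hull {a, b, c} \<inter> convex hull {a', b', c'} = convex hull ({a, b, c} \<inter> {a', b', c'})"
proof (rule convex_hull_Int_of_face)
  show "\<not> affine_dependent {a, b, c}" "\<not> affine_dependent {a', b', c'}"
    using assms flag_independent by blast+
  have "\<And>K L. K \<in> \<T> \<Longrightarrow> L \<in> \<T> \<Longrightarrow> K \<inter> L face_of K" 
    using triangulation by (auto simp: triangulation_def)
  then show "convex hull {a, b, c} \<inter> convex hull {a', b', c'} face_of convex hull {a, b, c}"
    "convex hull {a, b, c} \<inter> convex hull {a', b', c'} face_of convex hull {a', b', c'}"
    using assms unfolding flags_def by (fastforce simp: Int_commute)+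
qed

lemma flag_triangle_Int_subset:
  assumes "(a, b, c) \<in> flags \<T>" "(a', b', c') \<in> flags \<T>"
  shows "flag_triangle a b c \<inter> flag_triangle a' b' c' \<subseteq> convex hull (common_barycentres a b c a' b' c')"
  using flag_independent[OF assms(1)] flag_independent[OF assms(2)] hull_Int[OF assms]
  by (intro flag_triangle_Int) auto

text \<open>The common part lies in the hull of one barycentre for each shared flag member, and
  \<open>k\<close> points span dimension at most \<open>k - 1\<close>.\<close>

lemma flag_triangle_Int_dim:
  assumes "(a, b, c) \<in> flags \<T>" "(a', b', c') \<in> flags \<T>"
    and "S \<subseteq> flag_triangle a b c" "S \<subseteq> flag_triangle a' b' c'"
  shows "aff_dim S + 1 \<le> of_bool (a = a') + of_bool ({a, b} = {a', b'}) + of_bool ({a, b, c} = {a', b', c'})"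
proof -
  let ?C = "common_barycentres a b c a' b' c'"
  have "S \<subseteq> convex hull ?C"
    using assms(3,4) flag_triangle_Int_subset[OF assms(1,2)] by blast
  then have "aff_dim S \<le> aff_dim ?C"
    by (metis aff_dim_subset aff_dim_convex_hull)
  also have "\<dots> \<le> int (card ?C) - 1"
    unfolding common_barycentres_def by (intro aff_dim_le_card) auto
  also have "card ?C \<le> of_bool (a = a') + of_bool ({a, b} = {a', b'}) + of_bool ({a, b, c} = {a', b', c'})"
    unfolding common_barycentres_def by (intro order.trans[OF card_Un_le] add_mono) (auto simp: card_insert_if)
  finally show ?thesis
    by (auto split: if_splits)
qed

lemma flag_triangle_simplex:
  assumes "(a, b, c) \<in> flags \<T>"
  shows "2 simplex flag_triangle a b c"
  unfolding flag_triangle_def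
  using orient_nonzero_imp_affine_independent[OF orient_barycentres_nonzero[OF assms]]
  by (intro simplex_convex_hull) auto

text \<open>Dimension 2 forces the two flags to agree at all three levels, which recovers the
  ordering. Hence a small triangle has a well-defined colour.\<close>

lemma flag_triangle_inj:
  assumes "(a, b, c) \<in> flags \<T>" "(a', b', c') \<in> flags \<T>" "flag_triangle a b c = flag_triangle a' b' c'"
  shows "a = a' \<and> b = b' \<and> c = c'"
proof -
  have "aff_dim (flag_triangle a b c) = 2"
    using flag_triangle_simplex[OF assms(1)] by (rule aff_dim_simplex)
  then have "a = a'" "{a, b} = {a', b'}" "{a, b, c} = {a', b', c'}"
    using flag_triangle_Int_dim[OF assms(1,2), of "flag_triangle a b c"] assms(3)
    by (auto simp: of_bool_def split: if_splits)
  then show ?thesis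
    using flag_independent[OF assms(1)] flag_independent[OF assms(2)]
    by (auto simp: doubleton_eq_iff) 
qed

text \<open>A common side has dimension 1, so at least two of the three flag members are shared. If
  the old triangle changes, its third vertex passes to the other side of the line through
  \<open>a\<close> and \<open>b\<close>; if \<open>{a, b}\<close> changes, \<open>b\<close> and
  \<open>c\<close> are exchanged; if \<open>{a}\<close> changes, \<open>a\<close> and
  \<open>b\<close> are exchanged.\<close>

lemma flag_triangle_adjacent:
  assumes "(a, b, c) \<in> flags \<T>" "(a', b', c') \<in> flags \<T>" "flag_triangle a b c \<noteq> flag_triangle a' b' c'"
    and "s \<subseteq> flag_triangle a b c" "s \<subseteq> flag_triangle a' b' c'" "aff_dim s = 1"
  shows "orient a b c * orient a' b' c' < 0"
proof -
  note ind = flag_independent[OF assms(1)] flag_independent[OF assms(2)]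
  have sq: "orient a b c * orient a b c > 0"
    using ind(5) by (auto simp: zero_less_mult_iff linorder_neq_iff)
  have "2 \<le> (of_bool (a = a') + of_bool ({a, b} = {a', b'}) + of_bool ({a, b, c} = {a', b', c'}) :: int)"
    using flag_triangle_Int_dim[OF assms(1,2,4,5)] assms(6) by simp
  then consider "a = a'" "{a, b} = {a', b'}" | "a = a'" "{a, b, c} = {a', b', c'}"
    | "{a, b} = {a', b'}" "{a, b, c} = {a', b', c'}"
    by (auto simp: of_bool_def split: if_splits)
  then show ?thesis
  proof cases
    case 1
    then have eq: "a' = a" "b' = b" "c \<noteq> c'"
      using ind assms(3) by (auto simp: doubleton_eq_iff)
    then have "{a, b, c} \<inter> {a', b', c'} = {a, b}"
      using ind by auto
    then have "orient a b c * orient a b c' \<le> 0"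
      using hull_Int[OF assms(1,2)] eq ind by (intro orient_opposite) auto
    \<comment> \<open>Strictness comes from the non-degeneracy of both triangles.\<close>
    then show ?thesis
      using ind eq by (metis mult_eq_0_iff order_le_less)
  next
    case 2
    then have "b' \<in> {a, b, c}" "c' \<in> {a, b, c}"
      by blast+
    then have "a' = a" "b' = c" "c' = b"
      using 2 ind assms(3) by auto
    then show ?thesis
      using sq by (simp add: orient_swap(2)[of a b c])
  next
    case 3
    then have "a' \<in> {a, b}" "b' \<in> {a, b}" "c' \<in> {a, b, c}"
      by blast+
    moreover have "c' \<notin> {a', b'}"
      using ind(8,9) by simp
    then have "c' \<notin> {a, b}"
      unfolding 3(1) .
    ultimately have c: "c' = c" and ab: "a' = a \<or> a' = b" "b' = a \<or> b' = b"
      by simp_all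
    have "a' \<noteq> a"
    proof
      assume "a' = a"
      then have "b' = b"
        using ab(2) ind(7) by simp
      then show False
        using assms(3) \<open>a' = a\<close> c by simp
    qed
    then have "a' = b" "b' = a"
      using ab ind(7) by simp_all
    with c show ?thesis
      using sq by (simp add: orient_swap(1)[of a b c])
  qed
qed

lemma Union_barycentric_subdivision: "\<Union>(barycentric_subdivision \<T>) = \<Union>\<T>"
proof
  show "\<Union>(barycentric_subdivision \<T>) \<subseteq> \<Union>\<T>"
  proof (clarsimp simp: barycentric_subdivision_def flags_def)
    fix x a b c assume "x \<in> flag_triangle a b c" "convex hull {a, b, c} \<in> \<T>"
    then show "\<exists>K\<in>\<T>. x \<in> K"
      using flag_triangle_subset by blast
  qed
  show "\<Union>\<T> \<subseteq> \<Union>(barycentric_subdivision \<T>)"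
  proof
    fix x assume "x \<in> \<Union>\<T>"
    then obtain K where K: "K \<in> \<T>" "x \<in> K"
      by blast
    obtain a b c where abc: "K = convex hull {a, b, c}"
      using two_simplex_cases simplex2[OF K(1)] by blast
    then obtain a' b' c' where *: "{a', b', c'} = {a, b, c}" "x \<in> flag_triangle a' b' c'"
      using convex_hull_3_in_flag_triangle K(2) by metis
    have "(a', b', c') \<in> flags \<T>"
      using K(1) by (simp add: flags_def *(1) abc)
    then have "flag_triangle a' b' c' \<in> barycentric_subdivision \<T>"
      unfolding barycentric_subdivision_def by (rule rev_image_eqI) simp
    with *(2) show "x \<in> \<Union>(barycentric_subdivision \<T>)"
      by blast
  qed
qed

text \<open>The common barycentres are vertices of both small triangles, so their hull is the whole
  intersection, and a subset of the vertices of a simplex spans a face.\<close>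

lemma triangulation_barycentric_subdivision: "triangulation (barycentric_subdivision \<T>)"
proof -
  have "finite (barycentric_subdivision \<T>)"
    using finite_flags simplex2 triangulation
    by (auto simp: barycentric_subdivision_def triangulation_def)
  moreover have "flag_triangle a b c \<inter> flag_triangle a' b' c' face_of flag_triangle a b c"
    if abc: "(a, b, c) \<in> flags \<T>" "(a', b', c') \<in> flags \<T>" for a b c a' b' c'
  proof -
    let ?C = "common_barycentres a b c a' b' c'"
    have "flag_triangle a b c \<inter> flag_triangle a' b' c' \<subseteq> convex hull ?C"
      by (rule flag_triangle_Int_subset[OF abc])
    moreover have C: "?C \<subseteq> {a, (1/2) *\<^sub>R (a + b), (1/3) *\<^sub>R (a + b + c)}"
      by (auto simp: common_barycentres_def)
    moreover have "?C \<subseteq> {a', (1/2) *\<^sub>R (a' + b'), (1/3) *\<^sub>R (a' + b' + c')}" (is "_ \<subseteq> ?T")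
    proof -
      have mid: "(1/2) *\<^sub>R (a + b) \<in> ?T" if "{a, b} = {a', b'}"
      proof -
        have "a + b = a' + b'"
          using that by (auto simp: doubleton_eq_iff add.commute)
        then show ?thesis
          by simp
      qed
      have centre: "(1/3) *\<^sub>R (a + b + c) \<in> ?T" if "{a, b, c} = {a', b', c'}"
      proof -
        \<comment> \<open>A sum over the vertex set does not depend on the ordering; distinctness
          turns it into \<open>a + b + c\<close>.\<close>
        have "\<Sum>{a, b, c} = \<Sum>{a', b', c'}"
          using that by simp
        then have "a + b + c = a' + b' + c'"
          using flag_independent[OF abc(1)] flag_independent[OF abc(2)] by (simp add: add.assoc)
        then show ?thesis
          by simp
      qed
      show ?thesis
        unfolding common_barycentres_def using mid centre
        by (intro Un_least; split if_split; blast)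
    qed
    ultimately have "flag_triangle a b c \<inter> flag_triangle a' b' c' = convex hull ?C"
      unfolding flag_triangle_def by (intro subset_antisym Int_greatest hull_mono)
    then have "flag_triangle a b c \<inter> flag_triangle a' b' c' face_of
        convex hull {a, (1/2) *\<^sub>R (a + b), (1/3) *\<^sub>R (a + b + c)}"
      unfolding face_of_convex_hull_affine_independent
        [OF orient_nonzero_imp_affine_independent(1)[OF orient_barycentres_nonzero[OF abc(1)]]]
      using C by blast
    then show ?thesis
      unfolding flag_triangle_def .
  qed
  moreover have "\<exists>n. n simplex flag_triangle a b c" if "(a, b, c) \<in> flags \<T>" for a b c
    using flag_triangle_simplex[OF that] ..
  ultimately show ?thesis
    unfolding triangulation_def barycentric_subdivision_def by (clarsimp simp: split_beta)
qed

lemma bipartite_barycentric_subdivision: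
  "bipartite (associated_graph (barycentric_subdivision \<T>))"
proof -
  \<comment> \<open>The colour classes: they cover everything because orientations are non-zero, and
    they are disjoint because a small triangle determines its ordering.\<close>
  define U where "U = (\<lambda>(a, b, c). flag_triangle a b c) ` {(a, b, c) \<in> flags \<T>. orient a b c > 0}"
  define V where "V = (\<lambda>(a, b, c). flag_triangle a b c) ` {(a, b, c) \<in> flags \<T>. orient a b c < 0}"
  have "barycentric_subdivision \<T> = U \<union> V"
    using flag_independent(5) by (force simp: U_def V_def barycentric_subdivision_def linorder_neq_iff)
  moreover have False if "K \<in> U" "K \<in> V" for K
  proof -
    obtain a b c where *: "(a, b, c) \<in> flags \<T>" "K = flag_triangle a b c" "orient a b c > 0"
      using \<open>K \<in> U\<close> by (auto simp: U_def)
    obtain a' b' c' where **: "(a', b', c') \<in> flags \<T>" "K = flag_triangle a' b' c'" "orient a' b' c' < 0"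
      using \<open>K \<in> V\<close> by (auto simp: V_def)
    have "a = a' \<and> b = b' \<and> c = c'"
      using flag_triangle_inj[OF *(1) **(1)] *(2) **(2) by simp
    then show False
      using *(3) **(3) by simp
  qed
  then have "U \<inter> V = {}"
    by blast
  moreover have "K \<in> U \<and> L \<in> V \<or> K \<in> V \<and> L \<in> U"
    if KL: "K \<in> barycentric_subdivision \<T>" "L \<in> barycentric_subdivision \<T>" "K \<noteq> L" "s edge_of K" "s edge_of L" for K L s
  proof -
    obtain a b c where K: "(a, b, c) \<in> flags \<T>" "K = flag_triangle a b c"
      using KL(1) by (auto simp: barycentric_subdivision_def)
    obtain a' b' c' where L: "(a', b', c') \<in> flags \<T>" "L = flag_triangle a' b' c'"
      using KL(2) by (auto simp: barycentric_subdivision_def)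
    have "orient a b c * orient a' b' c' < 0"
      using KL(3-5) unfolding K(2) L(2)
      by (intro flag_triangle_adjacent[OF K(1) L(1), of s])
        (auto simp: edge_of_def dest: face_of_imp_subset)
    then show ?thesis
      using K L by (force simp: U_def V_def mult_less_0_iff)
  qed
  ultimately have "barycentric_subdivision \<T> = U \<union> V \<and> U \<inter> V = {} \<and>
      (\<forall>(K, L) \<in> parcs (associated_graph (barycentric_subdivision \<T>)).
          K \<in> U \<and> L \<in> V \<or> K \<in> V \<and> L \<in> U)"
    by (simp add: associated_graph_def) blast
  then show ?thesis
    unfolding bipartite_def by (metis (no_types, lifting) associated_graph_def pair_pre_digraph.select_convs(1))
qed

end

theorem theorem2p11:
  fixes \<Omega> :: "(real ^ 2) set"
  assumes "open \<Omega>" and "bounded \<Omega>" and "simply_connected \<Omega>" and "polygonal_region \<Omega>"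
  shows "\<exists>\<T>. triangulation_of \<T> \<Omega> \<and> bipartite (associated_graph \<T>)"
proof -
  obtain \<T> where \<T>: "triangulation_of \<T> \<Omega>"
    using polygonal_triangulation_exists[OF assms(1,2)] assms(4)
    unfolding polygonal_region_def by (metis order_refl)
  interpret plane_triangulation \<T>
    using \<T> by unfold_locales (auto simp: triangulation_of_def)
  have "2 simplex K" if "K \<in> barycentric_subdivision \<T>" for K
    using that flag_triangle_simplex by (auto simp: barycentric_subdivision_def)
  then have "triangulation_of (barycentric_subdivision \<T>) \<Omega>"
    using \<T> triangulation_barycentric_subdivision Union_barycentric_subdivision
    by (simp add: triangulation_of_def)
  then show ?thesis
    using bipartite_barycentric_subdivision by blast
qed

end
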